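(* Let $M$ be a finite loopfree matroid on a ground set of $n$ elements, $\mathcal{L}_M$ its lattice of flats, with least element $\hat0$ and greatest element $\hat1$, and let $\mathcal{F}(B(M))$ be the face poset of its Bergman fan. The map $$\psi:\mathcal{F}(B(M))\to\mathcal{D}(\mathcal{L}_M,\mathcal{G}_{max}),\qquad M_\omega\mapsto\{A\in\mathcal{L}_M\mid \operatorname{rank}(A)=|A\cap b|\ \text{ for all bases } b \text{ of } M_\omega\}$$ is (well defined and) an embedding of posets. An element $A\in\mathcal{D}(\mathcal{L}_M,\mathcal{G}_{max})$ is in the image of $\psi$ if and only if $\hat0\in A$ and $\hat1\in A$.
   Context: Decomposition complexes. A decomposition in a finite poset $P$ is a triple $(x,z,y)$ of elements of $P$ with $x\le z\le y$ such that there is an order isomorphism $\psi':[x,z]\times[z,y]\to[x,y]$ with $\psi'(u,z)=u$ for all $u\in[x,z]$ and $\psi'(z,v)=v$ for all $v\in[z,y]$. $\mathcal{G}_{max}$ is the set of all decompositions in $P$. For $A\subseteq P$, $\langle A\rangle$ is the smallest $B$ with $A\subseteq B\subseteq P$ such that for all $(x,z,y)\in\mathcal{G}_{max}$: $x,y\in B$ implies $z\in B$. $\mathcal{D}(P,\mathcal{G}_{max})=\{\langle C\rangle\mid C\text{ a non-empty chain in }P\}$, ordered by inclusion. Bergman fan. For a weight vector $\omega\in\mathbb{R}^n$ (indexed by the ground set), the matroid type $M_\omega$ is the matroid whose bases are the bases $b$ of $M$ of maximal weight $\sum_{i\in b}\omega_i$ (the possible outputs of the greedy algorithm for $\omega$);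 equivalently, the bases of $M_\omega$ are the vertices of a face of the matroid polytope $P_M$ (the convex hull of the incidence vectors of bases of $M$). The weight vectors inducing the same matroid type form a cone, these cones form a complete fan, and the Bergman fan is the subfan of the cones whose matroid type is loopfree. Its face poset $\mathcal{F}(B(M))$ is identified with the set of loopfree matroid types $M_\omega$, ordered by reversed inclusion of their sets of bases. *)

theory Defs
  imports Complex_Main "HOL-Algebra.Order"
begin

section \<open>Finite matroids\<close>

text \<open>
  Matroids are given by their bases, so that a matroid type of a matroid, which is described
  by its bases, is again an object of the same kind.
\<close>

record 'a matroid =
  ground :: "'a set"
  bases :: "'a set set"

locale matroid =
  fixes M :: "('a, 'm) matroid_scheme" (structure)
  assumes finite_ground: "finite (ground M)"
    and bases_subset: "B \<in> bases M \<Longrightarrow> B \<subseteq> ground M"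
    and bases_nonempty: "bases M \<noteq> {}"
    and basis_exchange:
      "\<lbrakk>B \<in> bases M; B' \<in> bases M; x \<in> B - B'\<rbrakk>
        \<Longrightarrow> \<exists>y\<in>B' - B. insert y (B - {x}) \<in> bases M"

definition indep :: "('a, 'm) matroid_scheme \<Rightarrow> 'a set \<Rightarrow> bool"
  where "indep M I \<longleftrightarrow> (\<exists>B\<in>bases M. I \<subseteq> B)"

definition rank_of :: "('a, 'm) matroid_scheme \<Rightarrow> 'a set \<Rightarrow> nat"
  where "rank_of M A = Max {card I |I. I \<subseteq> A \<and> indep M I}"

definition loop :: "('a, 'm) matroid_scheme \<Rightarrow> 'a \<Rightarrow> bool"
  where "loop M e \<longleftrightarrow> e \<in> ground M \<and> \<not> indep M {e}"

definition loopfree :: "('a, 'm) matroid_scheme \<Rightarrow> bool"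
  where "loopfree M \<longleftrightarrow> (\<forall>e. \<not> loop M e)"

definition flat :: "('a, 'm) matroid_scheme \<Rightarrow> 'a set \<Rightarrow> bool"
  where "flat M A \<longleftrightarrow>
    A \<subseteq> ground M \<and> (\<forall>e\<in>ground M - A. rank_of M A < rank_of M (insert e A))"

definition lattice_of_flats :: "('a, 'm) matroid_scheme \<Rightarrow> 'a set gorder"
  where "lattice_of_flats M = \<lparr>carrier = {A. flat M A}, eq = (=), le = (\<subseteq>)\<rparr>"


section \<open>Decomposition complexes\<close>

text \<open>
  A triple \<open>(x, z, y)\<close> is a decomposition if the interval from \<open>x\<close> to \<open>y\<close> is isomorphic, by an
  \<open>f\<close> that is the identity on both factors, to the product of the intervals from \<open>x\<close> to \<open>z\<close>
  and from \<open>z\<close> to \<open>y\<close> with the componentwise order.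
\<close>

definition decompositions :: "('p, 'c) gorder_scheme \<Rightarrow> ('p \<times> 'p \<times> 'p) set"
  where "decompositions P = {(x, z, y).
    x \<in> carrier P \<and> z \<in> carrier P \<and> y \<in> carrier P \<and> x \<sqsubseteq>\<^bsub>P\<^esub> z \<and> z \<sqsubseteq>\<^bsub>P\<^esub> y \<and>
    (\<exists>f. bij_betw f (\<lbrace>x..z\<rbrace>\<^bsub>P\<^esub> \<times> \<lbrace>z..y\<rbrace>\<^bsub>P\<^esub>) \<lbrace>x..y\<rbrace>\<^bsub>P\<^esub> \<and>
      (\<forall>u\<in>\<lbrace>x..z\<rbrace>\<^bsub>P\<^esub>. \<forall>v\<in>\<lbrace>z..y\<rbrace>\<^bsub>P\<^esub>. \<forall>u'\<in>\<lbrace>x..z\<rbrace>\<^bsub>P\<^esub>. \<forall>v'\<in>\<lbrace>z..y\<rbrace>\<^bsub>P\<^esub>.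
        f (u, v) \<sqsubseteq>\<^bsub>P\<^esub> f (u', v') \<longleftrightarrow> u \<sqsubseteq>\<^bsub>P\<^esub> u' \<and> v \<sqsubseteq>\<^bsub>P\<^esub> v') \<and>
      (\<forall>u\<in>\<lbrace>x..z\<rbrace>\<^bsub>P\<^esub>. f (u, z) = u) \<and>
      (\<forall>v\<in>\<lbrace>z..y\<rbrace>\<^bsub>P\<^esub>. f (z, v) = v))}"

text \<open>
  The closure is meant for \<open>A \<subseteq> carrier P\<close>. It is the smallest closed set containing \<open>A\<close>, since
  closed sets are stable under intersection.
\<close>

definition decomp_closure ::
    "('p, 'c) gorder_scheme \<Rightarrow> ('p \<times> 'p \<times> 'p) set \<Rightarrow> 'p set \<Rightarrow> 'p set"
  where "decomp_closure P G A =
    \<Inter>{B. A \<subseteq> B \<and> B \<subseteq> carrier P \<and> (\<forall>(x, z, y)\<in>G. x \<in> B \<and> y \<in> B \<longrightarrow> z \<in> B)}"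

definition decomposition_complex ::
    "('p, 'c) gorder_scheme \<Rightarrow> ('p \<times> 'p \<times> 'p) set \<Rightarrow> 'p set gorder"
  where "decomposition_complex P G = \<lparr>
    carrier = {decomp_closure P G C |C.
      C \<noteq> {} \<and> C \<subseteq> carrier P \<and> (\<forall>x\<in>C. \<forall>y\<in>C. x \<sqsubseteq>\<^bsub>P\<^esub> y \<or> y \<sqsubseteq>\<^bsub>P\<^esub> x)},
    eq = (=), le = (\<subseteq>)\<rparr>"


section \<open>The Bergman fan\<close>

text \<open>
  A weight vector is a function \<open>\<omega>\<close>, of which only the values on the ground set matter.
  Cones of the Bergman fan are represented by their matroid types. A larger cone has fewer bases
  of maximal weight, hence the order of the face poset is reversed inclusion of bases.
\<close>

definition matroid_type :: "('a, 'm) matroid_scheme \<Rightarrow> ('a \<Rightarrow> real) \<Rightarrow> 'a matroid"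
  where "matroid_type M \<omega> = \<lparr>
    ground = ground M,
    bases = {b \<in> bases M. \<forall>b'\<in>bases M. (\<Sum>i\<in>b'. \<omega> i) \<le> (\<Sum>i\<in>b. \<omega> i)}\<rparr>"

definition bergman_face_poset :: "('a, 'm) matroid_scheme \<Rightarrow> 'a matroid gorder"
  where "bergman_face_poset M = \<lparr>
    carrier = {matroid_type M \<omega> |\<omega>. loopfree (matroid_type M \<omega>)},
    eq = (=), le = (\<lambda>N N'. bases N' \<subseteq> bases N)\<rparr>"

definition bergman_to_decomp ::
    "('a, 'm) matroid_scheme \<Rightarrow> ('a, 'k) matroid_scheme \<Rightarrow> 'a set set"
  where "bergman_to_decomp M N =
    {A \<in> carrier (lattice_of_flats M). \<forall>b\<in>bases N. rank_of M A = card (A \<inter> b)}"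

end

theory Submission
  imports Defs
begin

text \<open>
  Write \<open>r\<close> for the rank of \<open>M\<close>, call a set \<open>S\<close> tight for a family of bases if
  \<open>r S = |S \<inter> b|\<close> for all \<open>b\<close> in the family, and call a basis adapted to a chain if all members
  of the chain are tight for it.

  The bases of \<open>M\<^sub>\<omega>\<close> are exactly the bases adapted to the chain of upper level sets of \<open>\<omega>\<close>
  (\<open>bases_matroid_type_eq_adapted\<close>), and conversely every chain determines a weight whose maximal
  bases are the bases adapted to it (\<open>bases_matroid_type_of_chain\<close>). If \<open>M\<^sub>\<omega>\<close> is loopfree, tight
  sets are flats (\<open>tight_flat\<close>), so \<open>\<psi> M\<^sub>\<omega>\<close> consists of all tight sets, and the chain of upper
  level sets is a chain of flats through the empty set and the ground set. The theorem therefore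
  comes down to the equation \<open>tight_adapted_eq_closure\<close>: for a chain of flats \<open>C\<close> that contains
  both extreme flats, the sets tight for all bases adapted to \<open>C\<close> form the decomposition closure
  of \<open>C\<close>.

  For this equation, decompositions of an interval of flats are first translated into ranks:
  for flats \<open>X \<subseteq> Z \<subseteq> Y\<close>, the triple \<open>(X, Z, Y)\<close> is a decomposition if and only if
  \<open>Z' = X \<union> (Y - Z)\<close> is a flat with \<open>r Z + r Z' = r X + r Y\<close> (\<open>decomposition_complement\<close>, \<open>decompositionI\<close>). A basis for which \<open>X\<close>
  and \<open>Y\<close> are tight then meets \<open>Z\<close> and \<open>Z'\<close> in as many elements as possible in total, hence in
  each of them, and so the tight sets are closed under decompositions. In the other direction,
  submodularity makes the tight sets a ring of sets on which \<open>r\<close> is modular, so that every tight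
  set with a tight relative complement gives a decomposition. Such complements exist between
  consecutive members of the chain, and a tight set \<open>A\<close> is reached from the chain through the sets
  \<open>A \<inter> c\<close> for \<open>c\<close> in the chain.

  The embedding property follows because \<open>\<psi> M\<^sub>\<omega>\<close> contains the upper level sets of \<open>\<omega>\<close>, which
  in turn determine the bases of \<open>M\<^sub>\<omega>\<close>. For the image, adjoining elements of its closure to a
  chain does not change the closure. Hence a chain whose closure contains the two extreme flats may
  be assumed to contain them, and the matroid type of the weight that it determines is a preimage.
\<close>

section \<open>Independence and rank\<close>

context matroid
begin

lemma finite_bases: "B \<in> bases M \<Longrightarrow> finite B"
  using bases_subset finite_ground finite_subset by blast

lemma indep_subset: "\<lbrakk>indep M J; I \<subseteq> J\<rbrakk> \<Longrightarrow> indep M I"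
  unfolding indep_def by blast

lemma indep_ground: "indep M I \<Longrightarrow> I \<subseteq> ground M"
  unfolding indep_def using bases_subset by blast

lemma indep_finite: "indep M I \<Longrightarrow> finite I"
  using indep_ground finite_ground finite_subset by blast

lemma indep_empty: "indep M {}"
  unfolding indep_def using bases_nonempty by blast

lemma bases_indep: "B \<in> bases M \<Longrightarrow> indep M B"
  unfolding indep_def by blast

lemma card_bases_le: "\<lbrakk>B \<in> bases M; B' \<in> bases M\<rbrakk> \<Longrightarrow> card B \<le> card B'"
proof (induction "card (B - B')" arbitrary: B rule: less_induct)
  case less
  show ?case
  proof (cases "B - B' = {}")
    case True
    then show ?thesis using less.prems finite_bases by (simp add: card_mono)
  next
    case False
    then obtain x where x: "x \<in> B - B'" by blast
    then obtain y where y: "y \<in> B' - B" "insert y (B - {x}) \<in> bases M"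
      using basis_exchange less.prems by blast
    have fin: "finite B" using less.prems finite_bases by blast
    have "insert y (B - {x}) - B' = (B - B') - {x}" using y by blast
    then have "card (insert y (B - {x}) - B') < card (B - B')"
      using x fin by (metis card_Diff1_less finite_Diff)
    then have "card (insert y (B - {x})) \<le> card B'"
      using less.hyps y(2) less.prems(2) by blast
    moreover have "card (insert y (B - {x})) = card B"
      using x y fin by (metis DiffD1 DiffD2 card_Suc_Diff1 card_insert_disjoint finite_Diff)
    ultimately show ?thesis by simp
  qed
qed

lemma card_bases: "\<lbrakk>B \<in> bases M; B' \<in> bases M\<rbrakk> \<Longrightarrow> card B = card B'"
  using card_bases_le by (simp add: le_antisym)

text \<open>
  The basis containing \<open>J\<close> is taken as close as possible to a basis containing \<open>I\<close>. If no
  augmentation exists, exchange shows that outside their intersection the first basis consists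
  of elements of \<open>J - I\<close> and the second one of elements of \<open>I - J\<close>, so that equicardinality of
  bases contradicts the assumption on the cardinalities.
\<close>

lemma indep_augment:
  assumes I: "indep M I" and J: "indep M J" and less: "card I < card J"
  shows "\<exists>e\<in>J - I. indep M (insert e I)"
proof (rule ccontr)
  assume no: "\<not> ?thesis"
  obtain B1 where B1: "B1 \<in> bases M" "I \<subseteq> B1" using I unfolding indep_def by blast
  obtain B0 where "B0 \<in> bases M \<and> J \<subseteq> B0" using J unfolding indep_def by blast
  from ex_has_least_nat[of "\<lambda>B. B \<in> bases M \<and> J \<subseteq> B", OF this, of "\<lambda>B. card (B - (J \<union> B1))"]
  obtain B2 where B2: "B2 \<in> bases M" "J \<subseteq> B2"
    and min: "\<And>B. B \<in> bases M \<Longrightarrow> J \<subseteq> B \<Longrightarrow> card (B2 - (J \<union> B1)) \<le> card (B - (J \<union> B1))"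
    by auto
  have fin: "finite B1" "finite B2" using B1 B2 finite_bases by auto
  have B1J: "B1 \<inter> J \<subseteq> I"
  proof
    fix e assume e: "e \<in> B1 \<inter> J"
    then have "indep M (insert e I)" using B1 unfolding indep_def by blast
    then show "e \<in> I" using no e by blast
  qed
  have "B2 - (J \<union> B1) = {}"
  proof (rule ccontr)
    assume "\<not> ?thesis"
    then obtain x where x: "x \<in> B2 - (J \<union> B1)" by blast
    then obtain y where y: "y \<in> B1 - B2" "insert y (B2 - {x}) \<in> bases M"
      using basis_exchange[OF B2(1) B1(1), of x] by blast
    have "insert y (B2 - {x}) - (J \<union> B1) = (B2 - (J \<union> B1)) - {x}" using y by blast
    then have "card (insert y (B2 - {x}) - (J \<union> B1)) < card (B2 - (J \<union> B1))"
      using x fin by (metis card_Diff1_less finite_Diff)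
    moreover have "J \<subseteq> insert y (B2 - {x})" using x B2 by blast
    ultimately show False using min[OF y(2)] by simp
  qed
  then have B21: "B2 - B1 = J - I" using B1 B2 B1J by blast
  have "B1 - B2 \<subseteq> I - J"
  proof
    fix x assume x: "x \<in> B1 - B2"
    then obtain y where y: "y \<in> B2 - B1" "insert y (B1 - {x}) \<in> bases M"
      using basis_exchange[OF B1(1) B2(1)] by blast
    have "x \<in> I"
    proof (rule ccontr)
      assume "x \<notin> I"
      then have "insert y I \<subseteq> insert y (B1 - {x})" using B1 by blast
      then have "indep M (insert y I)" using y(2) indep_subset bases_indep by blast
      then show False using no y B21 by blast
    qed
    then show "x \<in> I - J" using x B2 by blast
  qed
  then have "card (B1 - B2) \<le> card (I - J)" using indep_finite[OF I] by (simp add: card_mono)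
  moreover have "card (B1 - B2) = card (B2 - B1)"
    using card_bases[OF B1(1) B2(1)] fin by (simp add: card_Diff_subset_Int Int_commute)
  ultimately have "card (J - I) \<le> card (I - J)" using B21 by simp
  then show False
    using less indep_finite[OF I] indep_finite[OF J] card_less_sym_Diff[of I J] by simp
qed

abbreviation (input) "rank \<equiv> rank_of M"

lemma finite_indep_cards: "finite {card I |I. I \<subseteq> A \<and> indep M I}"
proof -
  have "{card I |I. I \<subseteq> A \<and> indep M I} \<subseteq> card ` Pow (ground M)" using indep_ground by auto
  then show ?thesis using finite_ground by (meson finite_Pow_iff finite_imageI finite_subset)
qed

lemma card_le_rank: "\<lbrakk>indep M I; I \<subseteq> A\<rbrakk> \<Longrightarrow> card I \<le> rank A"
  unfolding rank_of_def using finite_indep_cards by (intro Max_ge) auto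

lemma rank_attained: "\<exists>I. I \<subseteq> A \<and> indep M I \<and> card I = rank A"
proof -
  have "Max {card I |I. I \<subseteq> A \<and> indep M I} \<in> {card I |I. I \<subseteq> A \<and> indep M I}"
    using indep_empty by (intro Max_in finite_indep_cards) blast
  then show ?thesis unfolding rank_of_def by force
qed

lemma rank_mono: "A \<subseteq> B \<Longrightarrow> rank A \<le> rank B"
  using rank_attained[of A] card_le_rank by fastforce

lemma extend_indep:
  assumes "indep M I" "I \<subseteq> A"
  shows "\<exists>J. I \<subseteq> J \<and> J \<subseteq> A \<and> indep M J \<and> card J = rank A"
proof -
  let ?S = "{J. I \<subseteq> J \<and> J \<subseteq> A \<and> indep M J}"
  have "?S \<subseteq> Pow (ground M)" using indep_ground by blast
  then have "finite ?S" using finite_ground by (meson finite_Pow_iff finite_subset)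
  moreover have "?S \<noteq> {}" using assms by blast
  ultimately have "\<exists>J\<in>?S. \<forall>K\<in>?S. J \<subseteq> K \<longrightarrow> J = K" by (rule finite_has_maximal)
  then obtain J where J: "J \<in> ?S" and max: "\<And>K. K \<in> ?S \<Longrightarrow> J \<subseteq> K \<Longrightarrow> J = K" by meson
  obtain K where K: "K \<subseteq> A" "indep M K" "card K = rank A" using rank_attained by blast
  have "\<not> card J < card K"
  proof
    assume "card J < card K"
    then obtain e where e: "e \<in> K - J" "indep M (insert e J)"
      using indep_augment J K by blast
    then have "insert e J \<in> ?S" using J K by blast
    then show False using max[of "insert e J"] e by blast
  qed
  moreover have "card J \<le> rank A" using J card_le_rank by blast
  ultimately have "card J = rank A" using K by simp
  then show ?thesis using J by blast
qed

lemma card_Int_basis_le_rank: "b \<in> bases M \<Longrightarrow> card (S \<inter> b) \<le> rank S"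
  by (rule card_le_rank) (auto intro: indep_subset bases_indep)

lemma rank_ground: "b \<in> bases M \<Longrightarrow> rank (ground M) = card b"
proof -
  assume b: "b \<in> bases M"
  obtain I where I: "indep M I" "card I = rank (ground M)" using rank_attained by blast
  then obtain B where B: "B \<in> bases M" "I \<subseteq> B" unfolding indep_def by blast
  have "rank (ground M) \<le> card b"
    using I card_bases[OF b B(1)] card_mono[OF finite_bases[OF B(1)] B(2)] by simp
  then show ?thesis
    using card_le_rank[OF bases_indep[OF b] bases_subset[OF b]] by simp
qed

lemma indep_card_basis: "\<lbrakk>indep M I; card I = rank (ground M)\<rbrakk> \<Longrightarrow> I \<in> bases M"
proof -
  assume I: "indep M I" "card I = rank (ground M)"
  then obtain B where B: "B \<in> bases M" "I \<subseteq> B" unfolding indep_def by blast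
  have "I = B" using I rank_ground[OF B(1)] card_subset_eq[OF finite_bases[OF B(1)] B(2)] by simp
  then show ?thesis using B by simp
qed

lemma rank_empty: "rank {} = 0"
  using rank_attained[of "{}"] by auto

lemma rank_insert_le: "rank (insert e A) \<le> Suc (rank A)"
proof -
  obtain J where J: "J \<subseteq> insert e A" "indep M J" "card J = rank (insert e A)"
    using rank_attained by blast
  have "card (J - {e}) \<le> rank A" using J by (intro card_le_rank) (auto intro: indep_subset)
  moreover have "card J \<le> Suc (card (J - {e}))" by (auto simp: card_Diff_singleton_if)
  ultimately show ?thesis using J by simp
qed

lemma rank_submodular: "rank (A \<inter> B) + rank (A \<union> B) \<le> rank A + rank B"
proof -
  obtain I where I: "I \<subseteq> A \<inter> B" "indep M I" "card I = rank (A \<inter> B)" using rank_attained by blast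
  then obtain J where J: "I \<subseteq> J" "J \<subseteq> A \<union> B" "indep M J" "card J = rank (A \<union> B)"
    using extend_indep[of I "A \<union> B"] by blast
  have fin: "finite J" using J indep_finite by blast
  have "card I \<le> card (J \<inter> A \<inter> (J \<inter> B))" using I J fin by (intro card_mono) auto
  moreover have "card (J \<inter> A \<union> J \<inter> B) = card J" using J by (intro arg_cong[of _ _ card]) blast
  moreover have "card (J \<inter> A) + card (J \<inter> B) = card (J \<inter> A \<union> J \<inter> B) + card (J \<inter> A \<inter> (J \<inter> B))"
    using fin by (intro card_Un_Int) auto
  moreover have "card (J \<inter> A) \<le> rank A" "card (J \<inter> B) \<le> rank B"
    using J(3) by (intro card_le_rank; blast intro: indep_subset)+
  ultimately show ?thesis using I(3) J(4) by linarith
qed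


section \<open>Flats\<close>

lemma flat_rank_less: "\<lbrakk>flat M F; F \<subset> G; G \<subseteq> ground M\<rbrakk> \<Longrightarrow> rank F < rank G"
proof -
  assume F: "flat M F" "F \<subset> G" "G \<subseteq> ground M"
  then obtain e where e: "e \<in> G - F" by blast
  then have "rank F < rank (insert e F)" using F unfolding flat_def by blast
  also have "\<dots> \<le> rank G" using e F by (intro rank_mono) blast
  finally show ?thesis .
qed

text \<open>
  By submodularity, enlarging a set by a point can only raise the rank if it does so already for
  every subset.
\<close>

lemma rank_insert_less_mono:
  assumes "A \<subseteq> F" "rank F < rank (insert e F)"
  shows "rank A < rank (insert e A)"
proof -
  have "e \<notin> F" using assms by (auto simp: insert_absorb)
  then have "F \<inter> insert e A = A" "F \<union> insert e A = insert e F" using assms by auto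
  then show ?thesis using rank_submodular[of F "insert e A"] assms(2) by simp
qed

lemma flat_Int: "\<lbrakk>flat M F; flat M G\<rbrakk> \<Longrightarrow> flat M (F \<inter> G)"
  unfolding flat_def
proof (intro conjI ballI; elim conjE)
  assume F: "F \<subseteq> ground M" "\<forall>e\<in>ground M - F. rank F < rank (insert e F)"
    and G: "G \<subseteq> ground M" "\<forall>e\<in>ground M - G. rank G < rank (insert e G)"
  show "F \<inter> G \<subseteq> ground M" using F by blast
  fix e assume "e \<in> ground M - F \<inter> G"
  then consider "rank F < rank (insert e F)" | "rank G < rank (insert e G)" using F G by blast
  then show "rank (F \<inter> G) < rank (insert e (F \<inter> G))"
    by cases (erule rank_insert_less_mono[rotated], blast)+
qed

lemma flat_ground: "flat M (ground M)"
  unfolding flat_def by simp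

lemma flat_empty: "loopfree M \<Longrightarrow> flat M {}"
proof -
  assume "loopfree M"
  then have "indep M {e}" if "e \<in> ground M" for e using that unfolding loopfree_def loop_def by blast
  then have "0 < rank {e}" if "e \<in> ground M" for e
    using that card_le_rank[of "{e}" "{e}"] by simp
  then show ?thesis unfolding flat_def by (simp add: rank_empty)
qed

definition closure :: "'a set \<Rightarrow> 'a set"
  where "closure A = {e \<in> ground M. rank (insert e A) = rank A}"

lemma closure_superset: "A \<subseteq> ground M \<Longrightarrow> A \<subseteq> closure A"
  unfolding closure_def by (auto simp: insert_absorb)

lemma rank_closure: "A \<subseteq> ground M \<Longrightarrow> rank (closure A) = rank A"
proof (rule antisym)
  assume A: "A \<subseteq> ground M"
  show "rank A \<le> rank (closure A)" using closure_superset[OF A] by (rule rank_mono)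
  show "rank (closure A) \<le> rank A"
  proof (rule ccontr)
    assume "\<not> ?thesis"
    moreover obtain I where I: "I \<subseteq> A" "indep M I" "card I = rank A" using rank_attained by blast
    moreover obtain J where J: "J \<subseteq> closure A" "indep M J" "card J = rank (closure A)"
      using rank_attained by blast
    ultimately obtain e where e: "e \<in> J - I" "indep M (insert e I)"
      using indep_augment[of I J] by force
    have "Suc (card I) \<le> rank (insert e A)"
      using card_le_rank[OF e(2), of "insert e A"] e(1) I indep_finite[OF I(2)] by auto
    moreover have "rank (insert e A) = rank A" using e J unfolding closure_def by blast
    ultimately show False using I by simp
  qed
qed

lemma flat_closure: "A \<subseteq> ground M \<Longrightarrow> flat M (closure A)"
  unfolding flat_def
proof (intro conjI ballI)
  assume A: "A \<subseteq> ground M"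
  show "closure A \<subseteq> ground M" unfolding closure_def by blast
  fix e assume e: "e \<in> ground M - closure A"
  then have "rank A \<noteq> rank (insert e A)" unfolding closure_def by auto
  moreover have "rank A \<le> rank (insert e A)" by (intro rank_mono) blast
  moreover have "rank (insert e A) \<le> rank (insert e (closure A))"
    using closure_superset[OF A] by (intro rank_mono) blast
  ultimately show "rank (closure A) < rank (insert e (closure A))" using rank_closure[OF A] by simp
qed

lemma closure_subset_flat: "\<lbrakk>flat M F; A \<subseteq> F\<rbrakk> \<Longrightarrow> closure A \<subseteq> F"
proof
  fix e assume F: "flat M F" "A \<subseteq> F" and e: "e \<in> closure A"
  show "e \<in> F"
  proof (rule ccontr)
    assume "e \<notin> F"
    then have "rank F < rank (insert e F)" using F(1) e unfolding flat_def closure_def by blast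
    from rank_insert_less_mono[OF F(2) this] show False using e unfolding closure_def by simp
  qed
qed

text \<open>Every step from a flat to a larger one can be refined to a covering step, of rank one.\<close>

lemma flat_cover:
  assumes "flat M W" "flat M Y" "W \<subseteq> Y" "e \<in> Y - W"
  obtains a where "flat M a" "W \<subseteq> a" "a \<subseteq> Y" "e \<in> a" "rank a = Suc (rank W)"
proof
  have sub: "insert e W \<subseteq> ground M" using assms unfolding flat_def by blast
  show "flat M (closure (insert e W))" using flat_closure[OF sub] .
  show "W \<subseteq> closure (insert e W)" "e \<in> closure (insert e W)" using closure_superset[OF sub] by auto
  show "closure (insert e W) \<subseteq> Y" using assms by (intro closure_subset_flat) auto
  have "rank W < rank (insert e W)" using assms unfolding flat_def by blast
  then show "rank (closure (insert e W)) = Suc (rank W)"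
    using rank_closure[OF sub] rank_insert_le[of e W] by simp
qed


section \<open>Decompositions in the lattice of flats\<close>

lemma carrier_flats: "carrier (lattice_of_flats M) = {A. flat M A}"
  by (simp add: lattice_of_flats_def)

lemma le_flats: "A \<sqsubseteq>\<^bsub>lattice_of_flats M\<^esub> B \<longleftrightarrow> A \<subseteq> B"
  by (simp add: lattice_of_flats_def)

lemma interval_flats: "\<lbrace>A..B\<rbrace>\<^bsub>lattice_of_flats M\<^esub> = {W. flat M W \<and> A \<subseteq> W \<and> W \<subseteq> B}"
  by (simp add: at_least_at_most_def carrier_flats le_flats)

text \<open>
  The complementary factor of a decomposition \<open>(X, Z, Y)\<close> is the image \<open>Z'\<close> of \<open>(X, Y)\<close>. As an
  atom of a product lies in one of the two factors, \<open>Z \<union> Z' = Y\<close>. The rank equation holds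
  because the interval from \<open>X\<close> to \<open>Z'\<close> is isomorphic to the one from \<open>Z\<close> to \<open>Y\<close>: a maximal
  chain of the former is carried to a chain of the latter, which has at most \<open>rank Y - rank Z\<close>
  steps.
\<close>

lemma decomposition_complement:
  assumes "(X, Z, Y) \<in> decompositions (lattice_of_flats M)"
  shows "flat M (X \<union> (Y - Z)) \<and> rank Z + rank (X \<union> (Y - Z)) = rank X + rank Y"
proof -
  let ?P = "{W. flat M W \<and> X \<subseteq> W \<and> W \<subseteq> Z}" and ?Q = "{W. flat M W \<and> Z \<subseteq> W \<and> W \<subseteq> Y}"
  from assms obtain f where
    X: "flat M X" and Z: "flat M Z" and Y: "flat M Y" and XZ: "X \<subseteq> Z" and ZY: "Z \<subseteq> Y"
    and bij: "bij_betw f (?P \<times> ?Q) {W. flat M W \<and> X \<subseteq> W \<and> W \<subseteq> Y}"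
    and iso: "\<forall>u\<in>?P. \<forall>v\<in>?Q. \<forall>u'\<in>?P. \<forall>v'\<in>?Q. f (u, v) \<subseteq> f (u', v') \<longleftrightarrow> u \<subseteq> u' \<and> v \<subseteq> v'"
    and fst: "\<forall>u\<in>?P. f (u, Z) = u" and snd: "\<forall>v\<in>?Q. f (Z, v) = v"
    unfolding decompositions_def mem_Collect_eq prod.case carrier_flats le_flats interval_flats
    by (elim conjE exE) (rule that)
  have XP: "X \<in> ?P" and ZP: "Z \<in> ?P" and ZQ: "Z \<in> ?Q" and YQ: "Y \<in> ?Q"
    using X Y Z XZ ZY by auto
  have im: "flat M (f (u, v)) \<and> X \<subseteq> f (u, v) \<and> f (u, v) \<subseteq> Y" if "u \<in> ?P" "v \<in> ?Q" for u v
    using bij_betwE[OF bij] that by auto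
  have preim: "\<exists>u\<in>?P. \<exists>v\<in>?Q. W = f (u, v)" if "flat M W" "X \<subseteq> W" "W \<subseteq> Y" for W
    using bij_betw_imp_surj_on[OF bij] that by (smt (verit) SigmaE imageE mem_Collect_eq)
  have le: "f (u, v) \<subseteq> f (u', v') \<longleftrightarrow> u \<subseteq> u' \<and> v \<subseteq> v'"
    if "u \<in> ?P" "v \<in> ?Q" "u' \<in> ?P" "v' \<in> ?Q" for u v u' v'
    using bspec[OF bspec[OF bspec[OF bspec[OF iso that(1)] that(2)] that(3)] that(4)] .
  define Z' where "Z' = f (X, Y)"
  have Z': "flat M Z'" "X \<subseteq> Z'" "Z' \<subseteq> Y" unfolding Z'_def using im[OF XP YQ] by auto
  have Un: "Z \<union> Z' = Y"
  proof
    show "Z \<union> Z' \<subseteq> Y" using ZY Z' by blast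
    show "Y \<subseteq> Z \<union> Z'"
    proof
      fix e assume e: "e \<in> Y"
      show "e \<in> Z \<union> Z'"
      proof (cases "e \<in> X")
        case True
        then show ?thesis using XZ by blast
      next
        case False
        then obtain a where a: "flat M a" "X \<subseteq> a" "a \<subseteq> Y" "e \<in> a" "rank a = Suc (rank X)"
          using flat_cover[OF X Y _ , of e] e XZ ZY by blast
        obtain u v where u: "u \<in> ?P" and v: "v \<in> ?Q" and uv: "a = f (u, v)"
          using preim[OF a(1-3)] by (elim bexE) (rule that)
        show ?thesis
        proof (cases "u = X")
          case True
          then have "a \<subseteq> Z'" unfolding uv Z'_def using le[OF u v XP YQ] v by simp
          then show ?thesis using a by blast
        next
          case False
          \<comment> \<open>As \<open>a\<close> covers \<open>X\<close>, the flat \<open>u\<close> with \<open>X \<subset> u \<subseteq> a\<close> is \<open>a\<close> itself.\<close>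
          have "f (u, Z) \<subseteq> f (u, v)" using le[OF u ZQ u v] v by simp
          then have ua: "u \<subseteq> a" using fst u uv by auto
          have "X \<subset> u" "u \<subseteq> Z" "flat M u" using u False by auto
          moreover have "a \<subseteq> ground M" using a(1) unfolding flat_def by blast
          ultimately have "rank X < rank u" using ua by (intro flat_rank_less X) auto
          then have "\<not> u \<subset> a"
            using flat_rank_less[OF \<open>flat M u\<close> _ \<open>a \<subseteq> ground M\<close>] a(5) by fastforce
          then show ?thesis using ua \<open>u \<subseteq> Z\<close> a(4) by blast
        qed
      qed
    qed
  qed
  have Int: "Z \<inter> Z' = X"
  proof -
    have ZZ': "flat M (Z \<inter> Z')" "X \<subseteq> Z \<inter> Z'" "Z \<inter> Z' \<subseteq> Y" using flat_Int Z Z' XZ ZY by auto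
    obtain u v where u: "u \<in> ?P" and v: "v \<in> ?Q" and uv: "Z \<inter> Z' = f (u, v)"
      using preim[OF ZZ'] by (elim bexE) (rule that)
    have "f (u, v) \<subseteq> f (Z, Z)" using fst ZP uv by auto
    then have "v = Z" using le[OF u v ZP ZQ] v by auto
    moreover have "f (u, v) \<subseteq> f (X, Y)" using uv unfolding Z'_def by blast
    then have "u = X" using le[OF u v XP YQ] u by auto
    ultimately show ?thesis using uv fst XP by simp
  qed
  \<comment> \<open>A step of rank one from \<open>W\<close> towards \<open>Z'\<close> raises the rank of \<open>v\<close> by at least one.\<close>
  have chain: "rank Z' + rank v \<le> rank Y + rank W"
    if "W = f (X, v)" "v \<in> ?Q" "W \<subseteq> Z'" for W v
    using that
  proof (induction "rank Z' - rank W" arbitrary: W v rule: less_induct)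
    case less
    have W: "flat M W" "X \<subseteq> W" using im[OF XP less.prems(2)] less.prems(1) by auto
    show ?case
    proof (cases "W = Z'")
      case True
      then show ?thesis using less.prems rank_mono[of v Y] by simp
    next
      case False
      then obtain e where "e \<in> Z' - W" using less.prems by blast
      then obtain a where a: "flat M a" "W \<subseteq> a" "a \<subseteq> Z'" "e \<in> a" "rank a = Suc (rank W)"
        using flat_cover[OF W(1) Z'(1)] less.prems by blast
      obtain u v' where u: "u \<in> ?P" and v': "v' \<in> ?Q" and uv: "a = f (u, v')"
        using preim[OF a(1) subset_trans[OF W(2) a(2)] subset_trans[OF a(3) Z'(3)]]
        by (elim bexE) (rule that)
      have uX: "u = X" using le[OF u v' XP YQ] u a(3) unfolding uv Z'_def by auto
      have "v \<subseteq> v'" using le[OF XP less.prems(2) XP v'] a(2) uv uX less.prems(1) by simp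
      moreover have "v \<noteq> v'" using a(5) less.prems(1) uv uX by auto
      ultimately have "v \<subset> v'" by blast
      moreover have "flat M v" "v' \<subseteq> ground M" using less.prems(2) v' Y unfolding flat_def[of _ Y] by auto
      ultimately have "rank v < rank v'" using flat_rank_less by blast
      moreover have "rank Z' + rank v' \<le> rank Y + rank a"
      proof (rule less.hyps[OF _ _ v' a(3)])
        have "rank a \<le> rank Z'" using a(3) by (rule rank_mono)
        then show "rank Z' - rank a < rank Z' - rank W" using a by simp
        show "a = f (X, v')" using uv uX by simp
      qed
      ultimately show ?thesis using a by simp
    qed
  qed
  have "X = f (X, Z)" using fst XP by simp
  then have "rank Z' + rank Z \<le> rank Y + rank X" using chain[OF _ ZQ Z'(2)] by simp
  moreover have "rank X + rank Y \<le> rank Z + rank Z'" using rank_submodular[of Z Z'] Un Int by simp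
  moreover have "X \<union> (Y - Z) = Z'" using Un Int by blast
  ultimately show ?thesis using Z' by simp
qed

text \<open>
  Conversely, if \<open>Z\<close> and \<open>Z'\<close> are modular complements of each other in an interval, submodularity
  forces the rank of every \<open>W\<close> in the interval to be the sum of its contributions in \<open>Z\<close> and
  \<open>Z'\<close>, as in a direct sum of matroids.
\<close>

lemma rank_direct_sum:
  assumes "Z \<union> Z' = Y" "Z \<inter> Z' = X" "rank Z + rank Z' = rank X + rank Y" "X \<subseteq> W" "W \<subseteq> Y"
  shows "rank W + rank X = rank (W \<inter> Z) + rank (W \<inter> Z')"
proof -
  have "W \<inter> Z \<inter> (W \<inter> Z') = X" "W \<inter> Z \<union> W \<inter> Z' = W"
    "(W \<union> Z) \<inter> Z' = W \<inter> Z'" "(W \<union> Z) \<union> Z' = Y" using assms by auto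
  then show ?thesis
    using rank_submodular[of "W \<inter> Z" "W \<inter> Z'"] rank_submodular[of W Z]
      rank_submodular[of "W \<union> Z" Z'] assms(3) by simp
qed

lemma flat_direct_sum:
  assumes "Z \<union> Z' = Y" "Z \<inter> Z' = X" "rank Z + rank Z' = rank X + rank Y" "X \<subseteq> W" "W \<subseteq> Y"
    and "flat M Y" "flat M (W \<inter> Z)" "flat M (W \<inter> Z')"
  shows "flat M W"
  unfolding flat_def
proof (intro conjI ballI)
  show "W \<subseteq> ground M" using assms unfolding flat_def by blast
  fix e assume e: "e \<in> ground M - W"
  show "rank W < rank (insert e W)"
  proof (cases "e \<in> Y")
    case False
    then show ?thesis using rank_insert_less_mono[OF assms(5)] e assms(6) unfolding flat_def by blast
  next
    case True
    have sum: "rank W + rank X = rank (W \<inter> Z) + rank (W \<inter> Z')"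
      "rank (insert e W) + rank X = rank (insert e W \<inter> Z) + rank (insert e W \<inter> Z')"
      using rank_direct_sum[OF assms(1-3)] assms(4,5) True by blast+
    consider "e \<in> Z" | "e \<in> Z'" using True assms by blast
    then show ?thesis
    proof cases
      case 1
      then have "insert e W \<inter> Z = insert e (W \<inter> Z)" by blast
      moreover have "rank (W \<inter> Z) < rank (insert e (W \<inter> Z))" using assms(7) e unfolding flat_def by blast
      moreover have "rank (W \<inter> Z') \<le> rank (insert e W \<inter> Z')" by (intro rank_mono) blast
      ultimately show ?thesis using sum by simp
    next
      case 2
      then have "insert e W \<inter> Z' = insert e (W \<inter> Z')" by blast
      moreover have "rank (W \<inter> Z') < rank (insert e (W \<inter> Z'))" using assms(8) e unfolding flat_def by blast
      moreover have "rank (W \<inter> Z) \<le> rank (insert e W \<inter> Z)" by (intro rank_mono) blast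
      ultimately show ?thesis using sum by simp
    qed
  qed
qed


lemma decompositionI:
  assumes X: "flat M X" and Z: "flat M Z" and Y: "flat M Y" and Z': "flat M Z'"
    and Un: "Z \<union> Z' = Y" and Int: "Z \<inter> Z' = X" and rank: "rank Z + rank Z' = rank X + rank Y"
  shows "(X, Z, Y) \<in> decompositions (lattice_of_flats M)"
proof -
  let ?P = "{W. flat M W \<and> X \<subseteq> W \<and> W \<subseteq> Z}" and ?Q = "{W. flat M W \<and> Z \<subseteq> W \<and> W \<subseteq> Y}"
    and ?R = "{W. flat M W \<and> X \<subseteq> W \<and> W \<subseteq> Y}"
  define f where "f = (\<lambda>(u, v). u \<union> (v \<inter> Z'))"
  have flatI: "flat M W" if "X \<subseteq> W" "W \<subseteq> Y" "flat M (W \<inter> Z)" "flat M (W \<inter> Z')" for W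
    using flat_direct_sum[OF Un Int rank that(1,2) Y that(3,4)] .
  have proj: "(u \<union> v \<inter> Z') \<inter> Z = u" "(u \<union> v \<inter> Z') \<union> Z = v" if "u \<in> ?P" "v \<in> ?Q" for u v
    using that Un Int by blast+
  have bij: "bij_betw f (?P \<times> ?Q) ?R"
  proof (rule bij_betw_byWitness[where f' = "\<lambda>W. (W \<inter> Z, W \<union> Z)"])
    show "\<forall>p\<in>?P \<times> ?Q. (f p \<inter> Z, f p \<union> Z) = p"
    proof
      fix p assume "p \<in> ?P \<times> ?Q"
      then obtain u v where p: "p = (u, v)" "u \<in> ?P" "v \<in> ?Q" by (rule SigmaE)
      show "(f p \<inter> Z, f p \<union> Z) = p" unfolding p(1) f_def prod.case proj[OF p(2,3)] ..
    qed
    show "\<forall>W\<in>?R. f (W \<inter> Z, W \<union> Z) = W"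
    proof
      fix W assume "W \<in> ?R"
      then have "W \<inter> Z \<union> (W \<union> Z) \<inter> Z' = W" using Un Int by blast
      then show "f (W \<inter> Z, W \<union> Z) = W" unfolding f_def by simp
    qed
    show "f ` (?P \<times> ?Q) \<subseteq> ?R"
    proof (rule image_subsetI)
      fix p assume "p \<in> ?P \<times> ?Q"
      then obtain u v where p: "p = (u, v)" and "u \<in> ?P" "v \<in> ?Q" by (rule SigmaE)
      then have u: "flat M u" "X \<subseteq> u" "u \<subseteq> Z" and v: "flat M v" "Z \<subseteq> v" "v \<subseteq> Y" by auto
      have "(u \<union> v \<inter> Z') \<inter> Z = u" using u Int by blast
      moreover have "(u \<union> v \<inter> Z') \<inter> Z' = v \<inter> Z'" using u v Int by blast
      moreover have "X \<subseteq> u \<union> v \<inter> Z'" "u \<union> v \<inter> Z' \<subseteq> Y" using u v Un by blast+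
      ultimately show "f p \<in> ?R" unfolding p f_def using flatI u(1) flat_Int[OF v(1) Z'] by simp
    qed
    show "(\<lambda>W. (W \<inter> Z, W \<union> Z)) ` ?R \<subseteq> ?P \<times> ?Q"
    proof (rule image_subsetI)
      fix W assume "W \<in> ?R"
      then have W: "flat M W" "X \<subseteq> W" "W \<subseteq> Y" by auto
      have "(W \<union> Z) \<inter> Z = Z" by blast
      moreover have "(W \<union> Z) \<inter> Z' = W \<inter> Z'" using W Int by blast
      moreover have "X \<subseteq> W \<union> Z" "W \<union> Z \<subseteq> Y" using W Un by blast+
      ultimately have "flat M (W \<union> Z)" using flatI Z flat_Int[OF W(1) Z'] by simp
      moreover have "flat M (W \<inter> Z)" using W Z flat_Int by blast
      moreover have "X \<subseteq> W \<inter> Z" "W \<union> Z \<subseteq> Y" using W Int Un by blast+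
      ultimately show "(W \<inter> Z, W \<union> Z) \<in> ?P \<times> ?Q" by simp
    qed
  qed
  have le: "\<forall>u\<in>?P. \<forall>v\<in>?Q. \<forall>u'\<in>?P. \<forall>v'\<in>?Q. f (u, v) \<subseteq> f (u', v') \<longleftrightarrow> u \<subseteq> u' \<and> v \<subseteq> v'"
  proof (intro ballI)
    fix u v u' v' assume "u \<in> ?P" "v \<in> ?Q" "u' \<in> ?P" "v' \<in> ?Q"
    from proj[OF this(1,2)] proj[OF this(3,4)]
    show "f (u, v) \<subseteq> f (u', v') \<longleftrightarrow> u \<subseteq> u' \<and> v \<subseteq> v'" unfolding f_def prod.case by blast
  qed
  have fst: "\<forall>u\<in>?P. f (u, Z) = u" and snd: "\<forall>v\<in>?Q. f (Z, v) = v"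
    unfolding f_def prod.case using Int Un by blast+
  have "X \<subseteq> Z" "Z \<subseteq> Y" using Int Un by blast+
  then show ?thesis
    unfolding decompositions_def mem_Collect_eq prod.case carrier_flats le_flats interval_flats
    using bij le fst snd X Y Z by (intro conjI exI[of _ f])
qed


section \<open>Tight sets and bases adapted to a chain\<close>

text \<open>
  A set is tight for a family of bases if each of them contains a basis of the set. The map of the
  theorem sends a loopfree matroid type to the tight sets of its bases.
\<close>

definition tight_sets :: "'a set set \<Rightarrow> 'a set set"
  where "tight_sets \<B> = {S. S \<subseteq> ground M \<and> (\<forall>b\<in>\<B>. rank S = card (S \<inter> b))}"

definition adapted_bases :: "'a set set \<Rightarrow> 'a set set"
  where "adapted_bases C = {b \<in> bases M. \<forall>c\<in>C. card (c \<inter> b) = rank c}"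

lemma adapted_bases_subset: "adapted_bases C \<subseteq> bases M"
  unfolding adapted_bases_def by blast

lemma chain_tight: "\<forall>c\<in>C. c \<subseteq> ground M \<Longrightarrow> C \<subseteq> tight_sets (adapted_bases C)"
  unfolding adapted_bases_def tight_sets_def by auto

lemma card_Int_modular:
  "finite b \<Longrightarrow> card (S \<inter> b) + card (T \<inter> b) = card ((S \<inter> T) \<inter> b) + card ((S \<union> T) \<inter> b)"
proof -
  assume "finite b"
  then have "card (S \<inter> b) + card (T \<inter> b) = card (S \<inter> b \<union> T \<inter> b) + card (S \<inter> b \<inter> (T \<inter> b))"
    by (intro card_Un_Int) auto
  moreover have "S \<inter> b \<union> T \<inter> b = (S \<union> T) \<inter> b" "S \<inter> b \<inter> (T \<inter> b) = (S \<inter> T) \<inter> b" by blast+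
  ultimately show ?thesis by simp
qed

text \<open>
  Counting the elements of a basis is modular and the rank is submodular. Hence the bounds
  \<open>card (R \<inter> b) \<le> rank R\<close> for \<open>R = S \<inter> T\<close> and \<open>R = S \<union> T\<close> are attained if they are for \<open>S\<close> and \<open>T\<close>.
\<close>

lemma tight_Int_Un:
  assumes "\<B> \<subseteq> bases M" "S \<in> tight_sets \<B>" "T \<in> tight_sets \<B>"
  shows "S \<inter> T \<in> tight_sets \<B>" "S \<union> T \<in> tight_sets \<B>"
proof -
  have "rank (S \<inter> T) = card ((S \<inter> T) \<inter> b) \<and> rank (S \<union> T) = card ((S \<union> T) \<inter> b)" if b: "b \<in> \<B>" for b
  proof -
    have basis: "b \<in> bases M" using b assms(1) by blast
    have "rank S = card (S \<inter> b)" "rank T = card (T \<inter> b)"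
      using b assms(2,3) unfolding tight_sets_def by auto
    then show ?thesis
      using rank_submodular[of S T] card_Int_modular[OF finite_bases[OF basis], of S T]
        card_Int_basis_le_rank[OF basis, of "S \<inter> T"] card_Int_basis_le_rank[OF basis, of "S \<union> T"]
      by linarith
  qed
  then show "S \<inter> T \<in> tight_sets \<B>" "S \<union> T \<in> tight_sets \<B>"
    using assms(2,3) unfolding tight_sets_def by auto
qed

lemma tight_modular:
  assumes "\<B> \<subseteq> bases M" "\<B> \<noteq> {}" "S \<in> tight_sets \<B>" "T \<in> tight_sets \<B>"
  shows "rank S + rank T = rank (S \<inter> T) + rank (S \<union> T)"
proof -
  obtain b where b: "b \<in> \<B>" using assms(2) by blast
  then have "finite b" using assms(1) finite_bases by blast
  then have "card (S \<inter> b) + card (T \<inter> b) = card ((S \<inter> T) \<inter> b) + card ((S \<union> T) \<inter> b)"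
    by (rule card_Int_modular)
  moreover have "rank R = card (R \<inter> b)" if "R \<in> tight_sets \<B>" for R
    using that b unfolding tight_sets_def by blast
  ultimately show ?thesis using assms(3,4) tight_Int_Un[OF assms(1,3,4)] by simp
qed

text \<open>
  Looplessness of the matroid type enters here, in the form that its bases cover the ground set: a
  basis through a point outside of \<open>S\<close> shows that adding the point to \<open>S\<close> raises the rank.
\<close>

lemma tight_flat:
  assumes "\<B> \<subseteq> bases M" "ground M \<subseteq> \<Union>\<B>" "S \<in> tight_sets \<B>"
  shows "flat M S"
  unfolding flat_def
proof (intro conjI ballI)
  show "S \<subseteq> ground M" using assms(3) unfolding tight_sets_def by blast
  fix e assume e: "e \<in> ground M - S"
  then obtain b where b: "b \<in> \<B>" "e \<in> b" using assms(2) by blast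
  have basis: "b \<in> bases M" using b assms(1) by blast
  have "insert e S \<inter> b = insert e (S \<inter> b)" using b by blast
  then have "card (insert e S \<inter> b) = Suc (card (S \<inter> b))" using e finite_bases[OF basis] by simp
  moreover have "rank S = card (S \<inter> b)" using b assms(3) unfolding tight_sets_def by blast
  ultimately show "rank S < rank (insert e S)"
    using card_Int_basis_le_rank[OF basis, of "insert e S"] by simp
qed

text \<open>
  If \<open>b\<close> contains bases of \<open>X\<close> and of \<open>Y\<close>, then its parts in the two modular complements have
  together the largest possible cardinality, hence each part has.
\<close>

lemma tight_decomposition:
  assumes "\<B> \<subseteq> bases M" "X \<in> tight_sets \<B>" "Y \<in> tight_sets \<B>"
    and dec: "(X, Z, Y) \<in> decompositions (lattice_of_flats M)"
  shows "Z \<in> tight_sets \<B>"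
  unfolding tight_sets_def
proof (intro CollectI conjI ballI)
  have "flat M Z" and XZ: "X \<subseteq> Z" and ZY: "Z \<subseteq> Y"
    using dec unfolding decompositions_def by (auto simp: carrier_flats le_flats)
  then show "Z \<subseteq> ground M" unfolding flat_def by blast
  fix b assume b: "b \<in> \<B>"
  then have basis: "b \<in> bases M" using assms(1) by blast
  have "Z \<inter> (X \<union> (Y - Z)) = X" "Z \<union> (X \<union> (Y - Z)) = Y" using XZ ZY by blast+
  then have "card (Z \<inter> b) + card ((X \<union> (Y - Z)) \<inter> b) = card (X \<inter> b) + card (Y \<inter> b)"
    using card_Int_modular[OF finite_bases[OF basis], of Z "X \<union> (Y - Z)"] by simp
  moreover have "rank X = card (X \<inter> b)" "rank Y = card (Y \<inter> b)"
    using b assms(2,3) unfolding tight_sets_def by auto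
  ultimately show "rank Z = card (Z \<inter> b)"
    using conjunct2[OF decomposition_complement[OF dec]] card_Int_basis_le_rank[OF basis, of Z]
      card_Int_basis_le_rank[OF basis, of "X \<union> (Y - Z)"] by linarith
qed

lemma decomposition_tight:
  assumes "\<B> \<subseteq> bases M" "\<B> \<noteq> {}" "ground M \<subseteq> \<Union>\<B>" "Z \<in> tight_sets \<B>" "Z' \<in> tight_sets \<B>"
  shows "(Z \<inter> Z', Z, Z \<union> Z') \<in> decompositions (lattice_of_flats M)"
proof (rule decompositionI)
  show "flat M (Z \<inter> Z')" "flat M Z" "flat M (Z \<union> Z')" "flat M Z'"
    using tight_flat[OF assms(1,3)] assms(4,5) tight_Int_Un[OF assms(1,4,5)] by auto
qed (use tight_modular[OF assms(1,2,4,5)] in auto)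

lemma finite_family: "\<forall>c\<in>C. c \<subseteq> ground M \<Longrightarrow> finite C"
  using finite_ground by (meson Pow_iff finite_Pow_iff finite_subset subsetI)

text \<open>The greedy construction: a basis of each member is extended to a basis of the next one.\<close>

lemma adapted_bases_nonempty:
  assumes "chain\<^sub>\<subseteq> C" "\<forall>c\<in>C. c \<subseteq> ground M"
  shows "adapted_bases C \<noteq> {}"
proof -
  have "\<exists>I. indep M I \<and> I \<subseteq> \<Union>C \<and> (\<forall>c\<in>C. card (c \<inter> I) = rank c)"
    using finite_family[OF assms(2)] assms
  proof (induction C rule: finite_ranking_induct[where f = card])
    case empty
    then show ?case using indep_empty by blast
  next
    case (insert m C)
    have sub: "c \<subseteq> m" if "c \<in> C" for c
    proof -
      have "c \<subseteq> m \<or> m \<subseteq> c" using insert.prems(1) that unfolding chain_subset_def by blast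
      moreover have "card c \<le> card m" using insert.hyps(2) that by blast
      moreover have "finite c" using insert.prems(2) that finite_ground finite_subset by blast
      ultimately show ?thesis using card_seteq by blast
    qed
    have "chain\<^sub>\<subseteq> C" using insert.prems(1) unfolding chain_subset_def by blast
    then obtain I where I: "indep M I" "I \<subseteq> \<Union>C" "\<forall>c\<in>C. card (c \<inter> I) = rank c"
      using insert.IH insert.prems(2) by blast
    then have "I \<subseteq> m" using sub by blast
    then obtain J where J: "I \<subseteq> J" "J \<subseteq> m" "indep M J" "card J = rank m"
      using extend_indep[OF I(1)] by blast
    have "card (c \<inter> J) = rank c" if c: "c \<in> C" for c
    proof (rule antisym)
      show "card (c \<inter> J) \<le> rank c" using J(3) by (intro card_le_rank) (auto intro: indep_subset)
      have "card (c \<inter> I) \<le> card (c \<inter> J)" using J(1) indep_finite[OF J(3)] by (intro card_mono) auto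
      then show "rank c \<le> card (c \<inter> J)" using I(3) c by simp
    qed
    moreover have "m \<inter> J = J" using J(2) by blast
    ultimately have "\<forall>c\<in>insert m C. card (c \<inter> J) = rank c" using J(4) by simp
    moreover have "J \<subseteq> \<Union>(insert m C)" using J(2) by blast
    ultimately show ?case using J(3) by blast
  qed
  then obtain I where I: "indep M I" "\<forall>c\<in>C. card (c \<inter> I) = rank c" by blast
  then obtain b where b: "b \<in> bases M" "I \<subseteq> b" unfolding indep_def by blast
  have "card (c \<inter> b) = rank c" if c: "c \<in> C" for c
  proof (rule antisym)
    show "card (c \<inter> b) \<le> rank c" using card_Int_basis_le_rank[OF b(1)] .
    have "card (c \<inter> I) \<le> card (c \<inter> b)" using b(2) finite_bases[OF b(1)] by (intro card_mono) auto
    then show "rank c \<le> card (c \<inter> b)" using I(2) c by simp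
  qed
  then show ?thesis using b(1) unfolding adapted_bases_def by blast
qed

lemma adapted_basis_insert:
  assumes "chain\<^sub>\<subseteq> C" "\<forall>c\<in>C. c \<subseteq> ground M" "S \<subseteq> ground M" "\<forall>c\<in>C. c \<subseteq> S \<or> S \<subseteq> c"
  obtains b where "b \<in> adapted_bases C" "card (S \<inter> b) = rank S"
proof -
  have "chain\<^sub>\<subseteq> (insert S C)" using assms(1,4) unfolding chain_subset_def by blast
  then have "adapted_bases (insert S C) \<noteq> {}" using assms(2,3) by (intro adapted_bases_nonempty) auto
  then show thesis using that unfolding adapted_bases_def by auto
qed

lemma chain_greatest_member:
  assumes "chain\<^sub>\<subseteq> C" "finite C" "c0 \<in> C" "Q c0"
  obtains p where "p \<in> C" "Q p" "\<forall>c\<in>C. Q c \<longrightarrow> c \<subseteq> p"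
proof -
  have "finite {c \<in> C. Q c}" "{c \<in> C. Q c} \<noteq> {}" using assms by auto
  then obtain p where p: "p \<in> {c \<in> C. Q c}" "\<forall>c\<in>{c \<in> C. Q c}. p \<subseteq> c \<longrightarrow> p = c"
    using finite_has_maximal by meson
  have "c \<subseteq> p" if "c \<in> C" "Q c" for c
  proof -
    have "c \<subseteq> p \<or> p \<subseteq> c" using assms(1) p(1) that(1) unfolding chain_subset_def by blast
    then show ?thesis using p(2) that by auto
  qed
  then show thesis using that p(1) by blast
qed

text \<open>
  A given point \<open>e\<close> is not spanned by the greatest flat \<open>p\<close> of the chain that avoids it. A basis
  adapted also to \<open>insert e p\<close> must contain \<open>e\<close>.
\<close>

lemma adapted_bases_cover:
  assumes "chain\<^sub>\<subseteq> C" "\<forall>c\<in>C. flat M c" "{} \<in> C"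
  shows "ground M \<subseteq> \<Union>(adapted_bases C)"
proof
  fix e assume e: "e \<in> ground M"
  have sub: "\<forall>c\<in>C. c \<subseteq> ground M" using assms(2) unfolding flat_def by blast
  obtain p where p: "p \<in> C" "e \<notin> p" "\<forall>c\<in>C. e \<notin> c \<longrightarrow> c \<subseteq> p"
    using chain_greatest_member[OF assms(1) finite_family[OF sub] assms(3), of "\<lambda>c. e \<notin> c"] by auto
  have "\<forall>c\<in>C. c \<subseteq> insert e p \<or> insert e p \<subseteq> c"
  proof
    fix c assume c: "c \<in> C"
    then have "c \<subseteq> p \<or> p \<subseteq> c" using assms(1) p(1) unfolding chain_subset_def by blast
    then show "c \<subseteq> insert e p \<or> insert e p \<subseteq> c" using p(3) c by blast
  qed
  moreover have "insert e p \<subseteq> ground M" using sub p(1) e by blast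
  ultimately obtain b where b: "b \<in> adapted_bases C" "card (insert e p \<inter> b) = rank (insert e p)"
    using adapted_basis_insert[OF assms(1) sub] by blast
  have "rank p < rank (insert e p)" using assms(2) p(1,2) e unfolding flat_def by blast
  then have "card (p \<inter> b) < card (insert e p \<inter> b)" using b p(1) unfolding adapted_bases_def by auto
  then have "e \<in> b" by (metis Int_insert_left_if0 less_irrefl)
  then show "e \<in> \<Union>(adapted_bases C)" using b(1) by blast
qed

text \<open>
  Between consecutive members \<open>p\<close> and \<open>c\<close> of the chain, the tight sets are closed under
  complements. All adapted bases meet the complement in the same number of elements, and this
  number is its rank since some adapted basis contains a basis of the complement.
\<close>

lemma tight_relative_complement:
  assumes "chain\<^sub>\<subseteq> C" "\<forall>c\<in>C. c \<subseteq> ground M" "p \<in> C" "c \<in> C" "p \<subseteq> c"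
    and consecutive: "\<forall>d\<in>C. d \<subseteq> p \<or> c \<subseteq> d"
    and A: "A \<in> tight_sets (adapted_bases C)"
  shows "p \<union> (c - A) \<in> tight_sets (adapted_bases C)"
proof -
  let ?Z = "p \<union> A \<inter> c" and ?Z' = "p \<union> (c - A)"
  have "p \<in> tight_sets (adapted_bases C)" "c \<in> tight_sets (adapted_bases C)"
    using chain_tight[OF assms(2)] assms(3,4) by auto
  then have Z: "?Z \<in> tight_sets (adapted_bases C)" using tight_Int_Un[OF adapted_bases_subset] A by blast
  have eqs: "?Z \<inter> ?Z' = p" "?Z \<union> ?Z' = c" using assms(5) by blast+
  have const: "rank ?Z + card (?Z' \<inter> b) = rank p + rank c" if b: "b \<in> adapted_bases C" for b
  proof -
    have "finite b" using b adapted_bases_subset finite_bases by blast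
    then have "card (?Z \<inter> b) + card (?Z' \<inter> b) = card (p \<inter> b) + card (c \<inter> b)"
      using card_Int_modular[of b ?Z ?Z'] unfolding eqs by blast
    moreover have "rank ?Z = card (?Z \<inter> b)" using b Z unfolding tight_sets_def by blast
    moreover have "card (p \<inter> b) = rank p" "card (c \<inter> b) = rank c"
      using b assms(3,4) unfolding adapted_bases_def by auto
    ultimately show ?thesis by simp
  qed
  have "\<forall>d\<in>C. d \<subseteq> ?Z' \<or> ?Z' \<subseteq> d" using consecutive assms(5) by blast
  moreover have sub: "?Z' \<subseteq> ground M" using assms(2-4) by blast
  ultimately obtain b' where b': "b' \<in> adapted_bases C" "card (?Z' \<inter> b') = rank ?Z'"
    using adapted_basis_insert[OF assms(1,2)] by blast
  have "rank ?Z' = card (?Z' \<inter> b)" if "b \<in> adapted_bases C" for b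
    using const[OF that] const[OF b'(1)] b'(2) by linarith
  then show ?thesis using sub unfolding tight_sets_def by blast
qed


section \<open>Tight sets as a decomposition closure\<close>

lemma decomp_closure_superset: "A \<subseteq> decomp_closure P G A"
  unfolding decomp_closure_def by blast

lemma decomp_closure_closed:
  "\<lbrakk>(x, z, y) \<in> G; x \<in> decomp_closure P G A; y \<in> decomp_closure P G A\<rbrakk> \<Longrightarrow> z \<in> decomp_closure P G A"
  unfolding decomp_closure_def by (rule InterI) (drule InterD, assumption, drule InterD, auto)

lemma decomp_closure_least:
  "\<lbrakk>A \<subseteq> B; B \<subseteq> carrier P; \<And>x z y. \<lbrakk>(x, z, y) \<in> G; x \<in> B; y \<in> B\<rbrakk> \<Longrightarrow> z \<in> B\<rbrakk>
    \<Longrightarrow> decomp_closure P G A \<subseteq> B"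
  unfolding decomp_closure_def by (rule Inter_lower) auto

text \<open>
  To reach a tight set \<open>A\<close> from the chain, climb along the sets \<open>A \<inter> c\<close>. If \<open>p\<close> is the
  predecessor of \<open>c\<close> in the chain, then \<open>p \<union> A \<inter> c\<close> decomposes the interval from \<open>p\<close> to \<open>c\<close>,
  with complement \<open>p \<union> (c - A)\<close>, and \<open>A \<inter> c\<close> decomposes the interval from \<open>A \<inter> p\<close> to
  \<open>p \<union> A \<inter> c\<close>, with complement \<open>p\<close>.
\<close>

theorem tight_adapted_eq_closure:
  assumes chain: "chain\<^sub>\<subseteq> C" and flats: "\<forall>c\<in>C. flat M c" and bot: "{} \<in> C" and top: "ground M \<in> C"
  defines "L \<equiv> lattice_of_flats M"
  shows "tight_sets (adapted_bases C) = decomp_closure L (decompositions L) C"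
proof
  let ?T = "tight_sets (adapted_bases C)" and ?D = "decomp_closure L (decompositions L) C"
  have sub: "\<forall>c\<in>C. c \<subseteq> ground M" using flats unfolding flat_def by blast
  note cover = adapted_bases_cover[OF chain flats bot]
  note nonempty = adapted_bases_nonempty[OF chain sub]
  show "?D \<subseteq> ?T"
  proof (rule decomp_closure_least)
    show "C \<subseteq> ?T" using chain_tight[OF sub] .
    show "?T \<subseteq> carrier L"
      using tight_flat[OF adapted_bases_subset cover] unfolding L_def carrier_flats by blast
    show "Z \<in> ?T" if "(X, Z, Y) \<in> decompositions L" "X \<in> ?T" "Y \<in> ?T" for X Z Y
      using tight_decomposition[OF adapted_bases_subset that(2,3)] that(1) unfolding L_def by blast
  qed
  show "?T \<subseteq> ?D"
  proof
    fix A assume A: "A \<in> ?T"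
    have "A \<inter> c \<in> ?D" if "c \<in> C" for c
      using that
    proof (induction "card c" arbitrary: c rule: less_induct)
      case less
      have fin: "finite c" using sub less.prems finite_ground finite_subset by blast
      show ?case
      proof (cases "c = {}")
        case True
        then show ?thesis using bot decomp_closure_superset[of C L] by auto
      next
        case False
        then obtain p where p: "p \<in> C" "p \<subset> c" "\<forall>d\<in>C. d \<subset> c \<longrightarrow> d \<subseteq> p"
          using chain_greatest_member[OF chain finite_family[OF sub] bot, of "\<lambda>d. d \<subset> c"] by auto
        have consecutive: "\<forall>d\<in>C. d \<subseteq> p \<or> c \<subseteq> d"
        proof
          fix d assume d: "d \<in> C"
          then have "d \<subseteq> c \<or> c \<subseteq> d" using chain less.prems unfolding chain_subset_def by blast
          then show "d \<subseteq> p \<or> c \<subseteq> d" using p(3) d by blast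
        qed
        have pT: "p \<in> ?T" and cT: "c \<in> ?T" using chain_tight[OF sub] p(1) less.prems by auto
        have AcT: "A \<inter> c \<in> ?T" using tight_Int_Un[OF adapted_bases_subset A cT] by blast
        have ZT: "p \<union> A \<inter> c \<in> ?T" using tight_Int_Un[OF adapted_bases_subset pT AcT] by blast
        have Z'T: "p \<union> (c - A) \<in> ?T"
          using tight_relative_complement[OF chain sub p(1) less.prems _ consecutive A] p(2) by blast
        have "(p \<union> A \<inter> c) \<inter> (p \<union> (c - A)) = p" "(p \<union> A \<inter> c) \<union> (p \<union> (c - A)) = c"
          using p(2) by blast+
        then have "(p, p \<union> A \<inter> c, c) \<in> decompositions L"
          using decomposition_tight[OF adapted_bases_subset nonempty cover ZT Z'T]
          unfolding L_def by simp
        moreover have "p \<in> ?D" "c \<in> ?D"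
          using decomp_closure_superset[of C L] p(1) less.prems by auto
        ultimately have ZD: "p \<union> A \<inter> c \<in> ?D" by (rule decomp_closure_closed)
        have "card p < card c" using p(2) fin by (rule psubset_card_mono[rotated])
        then have ApD: "A \<inter> p \<in> ?D" using less.hyps p(1) by blast
        have "A \<inter> c \<inter> p = A \<inter> p" "A \<inter> c \<union> p = p \<union> A \<inter> c" using p(2) by blast+
        then have "(A \<inter> p, A \<inter> c, p \<union> A \<inter> c) \<in> decompositions L"
          using decomposition_tight[OF adapted_bases_subset nonempty cover AcT pT]
          unfolding L_def by simp
        then show ?thesis using ApD ZD by (rule decomp_closure_closed)
      qed
    qed
    from this[OF top] show "A \<in> ?D"
      using A unfolding tight_sets_def by (simp add: Int_absorb2)
  qed
qed


section \<open>Weights and matroid types\<close>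

text \<open>
  This form covers at once the sets of points of weight at least, or above, a given bound, whose
  ranks are compared to count the points of one weight in a basis, and also the empty set and the
  ground set.
\<close>

definition upper_level_sets :: "('a \<Rightarrow> real) \<Rightarrow> 'a set set"
  where "upper_level_sets \<omega> = {U. U \<subseteq> ground M \<and> (\<forall>e\<in>U. \<forall>x\<in>ground M - U. \<omega> x < \<omega> e)}"

lemma chain_upper_level_sets: "chain\<^sub>\<subseteq> (upper_level_sets \<omega>)"
  unfolding chain_subset_def
proof (intro ballI, rule ccontr)
  fix U V assume UV: "U \<in> upper_level_sets \<omega>" "V \<in> upper_level_sets \<omega>" "\<not> (U \<subseteq> V \<or> V \<subseteq> U)"
  then obtain e x where ex: "e \<in> U" "e \<notin> V" "x \<in> V" "x \<notin> U" by blast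
  moreover have "e \<in> ground M" "x \<in> ground M" using UV ex unfolding upper_level_sets_def by auto
  ultimately have "\<omega> x < \<omega> e" "\<omega> e < \<omega> x" using UV(1,2) unfolding upper_level_sets_def by auto
  then show False by simp
qed

lemma upper_level_sets_subset: "\<forall>U\<in>upper_level_sets \<omega>. U \<subseteq> ground M"
  unfolding upper_level_sets_def by blast

lemma bases_matroid_type_iff:
  "b \<in> bases (matroid_type M \<omega>) \<longleftrightarrow> b \<in> bases M \<and> (\<forall>b'\<in>bases M. sum \<omega> b' \<le> sum \<omega> b)"
  unfolding matroid_type_def by simp

lemma bases_matroid_type_subset: "bases (matroid_type M \<omega>) \<subseteq> bases M"
  using bases_matroid_type_iff by blast

lemma bases_matroid_type_nonempty: "bases (matroid_type M \<omega>) \<noteq> {}"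
proof -
  have "bases M \<subseteq> Pow (ground M)" using bases_subset by blast
  then have "finite (bases M)" using finite_ground by (meson finite_Pow_iff finite_subset)
  then have "Max (sum \<omega> ` bases M) \<in> sum \<omega> ` bases M" using bases_nonempty by (intro Max_in) auto
  then obtain b where b: "Max (sum \<omega> ` bases M) = sum \<omega> b" "b \<in> bases M" by (rule imageE)
  have "sum \<omega> b' \<le> sum \<omega> b" if "b' \<in> bases M" for b'
    using Max_ge[of "sum \<omega> ` bases M" "sum \<omega> b'"] \<open>finite (bases M)\<close> that b(1) by simp
  then show ?thesis using b(2) bases_matroid_type_iff by blast
qed

text \<open>
  If a basis missed the rank of an upper level set \<open>U\<close>, then some \<open>e\<close> in \<open>U\<close> could be exchanged
  for an element \<open>x\<close> of the basis outside of \<open>U\<close>, and the weight would increase.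
\<close>

lemma max_weight_adapted:
  assumes b: "b \<in> bases (matroid_type M \<omega>)"
  shows "b \<in> adapted_bases (upper_level_sets \<omega>)"
  unfolding adapted_bases_def
proof (intro CollectI conjI ballI)
  show basis: "b \<in> bases M" using b bases_matroid_type_iff by blast
  note fin = finite_bases[OF basis]
  fix U assume U: "U \<in> upper_level_sets \<omega>"
  have sub: "U \<subseteq> ground M" using U unfolding upper_level_sets_def by blast
  show "card (U \<inter> b) = rank U"
  proof (rule ccontr)
    assume "card (U \<inter> b) \<noteq> rank U"
    then have less: "card (U \<inter> b) < rank U" using card_Int_basis_le_rank[OF basis, of U] by simp
    obtain J where J: "J \<subseteq> U" "indep M J" "card J = rank U" using rank_attained by blast
    have "indep M (U \<inter> b)" by (rule indep_subset[OF bases_indep[OF basis]]) blast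
    moreover have "card (U \<inter> b) < card J" using less J(3) by simp
    ultimately obtain e where e: "e \<in> J - U \<inter> b" "indep M (insert e (U \<inter> b))"
      using indep_augment[OF _ J(2)] by blast
    then have eU: "e \<in> U" "e \<notin> b" using J(1) by auto
    obtain K where K: "insert e (U \<inter> b) \<subseteq> K" "K \<subseteq> insert e b" "indep M K"
      "card K = rank (insert e b)"
      using extend_indep[OF e(2), of "insert e b"] by blast
    have "card b \<le> rank (insert e b)" using card_le_rank[OF bases_indep[OF basis]] subset_insertI by blast
    moreover have "rank (insert e b) \<le> rank (ground M)"
      using eU(1) sub bases_subset[OF basis] by (intro rank_mono) blast
    ultimately have cardK: "card K = card b" using K(4) rank_ground[OF basis] by simp
    then have Kbasis: "K \<in> bases M" using indep_card_basis[OF K(3)] rank_ground[OF basis] by simp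
    have "\<not> b \<subseteq> K"
    proof
      assume "b \<subseteq> K"
      then have "b = K" using card_subset_eq[OF indep_finite[OF K(3)]] cardK by simp
      then show False using K(1) eU(2) by blast
    qed
    then obtain x where x: "x \<in> b" "x \<notin> K" by blast
    have "card (insert e (b - {x})) = card b"
      using x(1) eU(2) fin card_Suc_Diff1[OF fin x(1)] by simp
    moreover have "K \<subseteq> insert e (b - {x})" using K(2) x(2) by blast
    ultimately have "K = insert e (b - {x})" using cardK fin by (intro card_subset_eq) auto
    then have "sum \<omega> K = \<omega> e + (sum \<omega> b - \<omega> x)"
      using eU(2) fin x(1) by (simp add: sum_diff1)
    moreover have "x \<in> ground M - U" using x K(1) bases_subset[OF basis] by blast
    then have "\<omega> x < \<omega> e" using U eU(1) unfolding upper_level_sets_def by blast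
    moreover have "sum \<omega> K \<le> sum \<omega> b" using b Kbasis bases_matroid_type_iff by blast
    ultimately show False by simp
  qed
qed

text \<open>
  Adaptedness also suffices for maximal weight: the ranks of the upper level sets determine how
  many elements of each weight an adapted basis has, so all adapted bases have the same weight. One of them has maximal weight.
\<close>

lemma bases_matroid_type_eq_adapted:
  "bases (matroid_type M \<omega>) = adapted_bases (upper_level_sets \<omega>)"
proof
  let ?C = "upper_level_sets \<omega>"
  show "bases (matroid_type M \<omega>) \<subseteq> adapted_bases ?C" using max_weight_adapted by blast
  define count where "count v = rank {i \<in> ground M. v \<le> \<omega> i} - rank {i \<in> ground M. v < \<omega> i}" for v
  have weight: "sum \<omega> b = (\<Sum>v\<in>\<omega> ` ground M. real (count v) * v)" if b: "b \<in> adapted_bases ?C" for b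
  proof -
    have basis: "b \<in> bases M" using b adapted_bases_subset by blast
    note fin = finite_bases[OF basis]
    have level: "sum \<omega> {i \<in> b. \<omega> i = v} = real (count v) * v" for v
    proof -
      let ?ge = "{i \<in> ground M. v \<le> \<omega> i}" and ?gr = "{i \<in> ground M. v < \<omega> i}"
      have "{i \<in> b. \<omega> i = v} = ?ge \<inter> b - ?gr \<inter> b" using bases_subset[OF basis] by force
      then have "card {i \<in> b. \<omega> i = v} = card (?ge \<inter> b - ?gr \<inter> b)" by simp
      also have "\<dots> = card (?ge \<inter> b) - card (?gr \<inter> b)"
        using fin by (intro card_Diff_subset) auto
      also have "\<dots> = count v"
      proof -
        have "?ge \<in> ?C" "?gr \<in> ?C" unfolding upper_level_sets_def by auto
        then show ?thesis using b unfolding adapted_bases_def count_def by auto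
      qed
      finally show ?thesis by simp
    qed
    have "(\<Sum>v\<in>\<omega> ` ground M. real (count v) * v) = (\<Sum>v\<in>\<omega> ` ground M. sum \<omega> {i \<in> b. \<omega> i = v})"
      by (simp only: level)
    also have "\<dots> = sum \<omega> b"
      using fin finite_ground bases_subset[OF basis] by (intro sum.group) auto
    finally show ?thesis by simp
  qed
  obtain b0 where b0: "b0 \<in> bases (matroid_type M \<omega>)" using bases_matroid_type_nonempty by blast
  show "adapted_bases ?C \<subseteq> bases (matroid_type M \<omega>)"
  proof
    fix b assume b: "b \<in> adapted_bases ?C"
    then have "sum \<omega> b = sum \<omega> b0" using weight max_weight_adapted[OF b0] by simp
    moreover have "b \<in> bases M" using b adapted_bases_subset by blast
    ultimately show "b \<in> bases (matroid_type M \<omega>)" using b0 bases_matroid_type_iff by simp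
  qed
qed

text \<open>
  Every chain arises from a weight: if a point weighs as many members of the chain as contain it,
  then the weight of a basis is the sum of its cardinalities in these members, hence at most the
  sum of their ranks.
\<close>

lemma bases_matroid_type_of_chain:
  assumes "chain\<^sub>\<subseteq> C" "\<forall>c\<in>C. c \<subseteq> ground M"
  shows "bases (matroid_type M (\<lambda>i. real (card {c \<in> C. i \<in> c}))) = adapted_bases C"
proof -
  let ?w = "\<lambda>i. real (card {c \<in> C. i \<in> c})"
  note finC = finite_family[OF assms(2)]
  have weight: "sum ?w b = real (\<Sum>c\<in>C. card (c \<inter> b))" if b: "b \<in> bases M" for b
  proof -
    have "card {c \<in> C. i \<in> c} = (\<Sum>c\<in>C. if i \<in> c then 1 else 0)" for i
      using finC by (simp add: sum.If_cases Collect_conj_eq)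
    then have "(\<Sum>i\<in>b. card {c \<in> C. i \<in> c}) = (\<Sum>i\<in>b. \<Sum>c\<in>C. if i \<in> c then 1 else 0)" by simp
    also have "\<dots> = (\<Sum>c\<in>C. \<Sum>i\<in>b. if i \<in> c then 1 else 0)" by (rule sum.swap)
    also have "\<dots> = (\<Sum>c\<in>C. card (c \<inter> b))"
      using finite_bases[OF b] by (simp add: sum.If_cases Int_commute)
    finally show ?thesis by (metis of_nat_sum)
  qed
  have le: "(\<Sum>c\<in>C. card (c \<inter> b)) \<le> (\<Sum>c\<in>C. rank c)" if "b \<in> bases M" for b
    using card_Int_basis_le_rank[OF that] by (intro sum_mono)
  have eq: "(\<Sum>c\<in>C. card (c \<inter> b)) = (\<Sum>c\<in>C. rank c)" if "b \<in> adapted_bases C" for b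
    using that unfolding adapted_bases_def by simp
  obtain b0 where b0: "b0 \<in> adapted_bases C" using adapted_bases_nonempty[OF assms] by blast
  then have b0': "b0 \<in> bases M" using adapted_bases_subset by blast
  show ?thesis
  proof (intro equalityI subsetI)
    fix b assume "b \<in> bases (matroid_type M ?w)"
    then have b: "b \<in> bases M" and "sum ?w b0 \<le> sum ?w b"
      using bases_matroid_type_iff b0' by blast+
    then have "real (\<Sum>c\<in>C. card (c \<inter> b0)) \<le> real (\<Sum>c\<in>C. card (c \<inter> b))"
      using weight[OF b] weight[OF b0'] by linarith
    then have "(\<Sum>c\<in>C. rank c) \<le> (\<Sum>c\<in>C. card (c \<inter> b))"
      using eq[OF b0] by (simp only: of_nat_le_iff)
    then have "(\<Sum>c\<in>C. card (c \<inter> b)) = (\<Sum>c\<in>C. rank c)" using le[OF b] by simp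
    then have "\<forall>c\<in>C. card (c \<inter> b) = rank c"
      using sum_mono_inv[of "\<lambda>c. card (c \<inter> b)" C rank] card_Int_basis_le_rank[OF b] finC by blast
    then show "b \<in> adapted_bases C" using b unfolding adapted_bases_def by blast
  next
    fix b assume b: "b \<in> adapted_bases C"
    then have basis: "b \<in> bases M" using adapted_bases_subset by blast
    have "sum ?w b' \<le> sum ?w b" if "b' \<in> bases M" for b'
      unfolding weight[OF that] weight[OF basis] eq[OF b] using le[OF that] by (simp only: of_nat_le_iff)
    then show "b \<in> bases (matroid_type M ?w)" using basis bases_matroid_type_iff by blast
  qed
qed

lemma loopfree_matroid_type: "loopfree (matroid_type M \<omega>) \<longleftrightarrow> ground M \<subseteq> \<Union>(bases (matroid_type M \<omega>))"
proof -
  have "ground (matroid_type M \<omega>) = ground M" by (simp add: matroid_type_def)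
  then show ?thesis unfolding loopfree_def loop_def indep_def by auto
qed

lemma flat_upper_level_set:
  assumes "loopfree (matroid_type M \<omega>)" "U \<in> upper_level_sets \<omega>"
  shows "flat M U"
proof (rule tight_flat)
  show "U \<in> tight_sets (bases (matroid_type M \<omega>))"
    using chain_tight[OF upper_level_sets_subset] assms(2)
    unfolding bases_matroid_type_eq_adapted by blast
qed (use assms(1) bases_matroid_type_subset loopfree_matroid_type in auto)

lemma bergman_to_decomp_eq_tight:
  assumes "loopfree (matroid_type M \<omega>)"
  shows "bergman_to_decomp M (matroid_type M \<omega>) = tight_sets (bases (matroid_type M \<omega>))"
proof -
  have "flat M S" if "S \<in> tight_sets (bases (matroid_type M \<omega>))" for S
    using tight_flat[OF bases_matroid_type_subset _ that] assms loopfree_matroid_type by blast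
  then show ?thesis
    unfolding bergman_to_decomp_def carrier_flats tight_sets_def flat_def by blast
qed

lemma bergman_to_decomp_eq_closure:
  assumes "loopfree (matroid_type M \<omega>)"
  defines "L \<equiv> lattice_of_flats M"
  shows "bergman_to_decomp M (matroid_type M \<omega>)
    = decomp_closure L (decompositions L) (upper_level_sets \<omega>)"
proof -
  have "{} \<in> upper_level_sets \<omega>" "ground M \<in> upper_level_sets \<omega>" unfolding upper_level_sets_def by auto
  then have "tight_sets (adapted_bases (upper_level_sets \<omega>))
    = decomp_closure L (decompositions L) (upper_level_sets \<omega>)"
    using chain_upper_level_sets flat_upper_level_set[OF assms(1)]
    unfolding L_def by (intro tight_adapted_eq_closure) auto
  then show ?thesis
    using bergman_to_decomp_eq_tight[OF assms(1)] bases_matroid_type_eq_adapted by simp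
qed

lemma bottom_flats: "loopfree M \<Longrightarrow> \<bottom>\<^bsub>lattice_of_flats M\<^esub> = {}"
proof -
  assume "loopfree M"
  then have "least (lattice_of_flats M) x (carrier (lattice_of_flats M)) \<longleftrightarrow> x = {}" for x
    using flat_empty unfolding least_def carrier_flats le_flats by auto
  then show ?thesis unfolding bottom_def by simp
qed

lemma top_flats: "\<top>\<^bsub>lattice_of_flats M\<^esub> = ground M"
proof -
  have "greatest (lattice_of_flats M) x (carrier (lattice_of_flats M)) \<longleftrightarrow> x = ground M" for x
    using flat_ground unfolding greatest_def carrier_flats le_flats by (auto simp: flat_def)
  then show ?thesis unfolding top_def by simp
qed

end

section \<open>The embedding of the Bergman fan\<close>

lemma weak_partial_order_bergman: "weak_partial_order (bergman_face_poset M)"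
proof
  fix N N' assume "N \<in> carrier (bergman_face_poset M)" "N' \<in> carrier (bergman_face_poset M)"
    and "N \<sqsubseteq>\<^bsub>bergman_face_poset M\<^esub> N'" "N' \<sqsubseteq>\<^bsub>bergman_face_poset M\<^esub> N"
  then have "bases N = bases N'" "ground N = ground N'"
    by (auto simp: bergman_face_poset_def matroid_type_def)
  then show "N .=\<^bsub>bergman_face_poset M\<^esub> N'" by (simp add: bergman_face_poset_def)
qed (auto simp: bergman_face_poset_def)

lemma weak_partial_order_complex: "weak_partial_order (decomposition_complex P G)"
  by unfold_locales (auto simp: decomposition_complex_def)

theorem theorem7p5:
  fixes M :: "'a matroid"
  assumes "matroid M" and "loopfree M"
  defines "L \<equiv> lattice_of_flats M"
  defines "D \<equiv> decomposition_complex L (decompositions L)"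
  defines "F \<equiv> bergman_face_poset M"
  shows "bergman_to_decomp M \<in> carrier F \<rightarrow> carrier D
    \<and> order_emb F D (bergman_to_decomp M)
    \<and> (\<forall>A\<in>carrier D. A \<in> bergman_to_decomp M ` carrier F \<longleftrightarrow> \<bottom>\<^bsub>L\<^esub> \<in> A \<and> \<top>\<^bsub>L\<^esub> \<in> A)"
proof -
  interpret matroid M by fact
  let ?cl = "decomp_closure L (decompositions L)" and ?\<psi> = "bergman_to_decomp M"
  have F: "carrier F = {matroid_type M \<omega> |\<omega>. loopfree (matroid_type M \<omega>)}"
    by (simp add: F_def bergman_face_poset_def)
  have F_cases: "\<exists>\<omega>. N = matroid_type M \<omega> \<and> loopfree (matroid_type M \<omega>)" if "N \<in> carrier F" for N
    using that unfolding F mem_Collect_eq .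
  have D: "carrier D = {?cl C |C. C \<noteq> {} \<and> (\<forall>c\<in>C. flat M c) \<and> chain\<^sub>\<subseteq> C}"
    unfolding D_def decomposition_complex_def L_def carrier_flats le_flats chain_subset_def by auto
  note closure = bergman_to_decomp_eq_closure[folded L_def]
  have bounds: "{} \<in> upper_level_sets \<omega>" "ground M \<in> upper_level_sets \<omega>" for \<omega>
    unfolding upper_level_sets_def by auto
  have "?\<psi> N \<in> carrier D" if mem: "N \<in> carrier F" for N
  proof -
    obtain \<omega> where \<omega>: "N = matroid_type M \<omega>" "loopfree (matroid_type M \<omega>)"
      using F_cases[OF mem] by (elim exE conjE)
    have "?\<psi> N = ?cl (upper_level_sets \<omega>)" using closure[OF \<omega>(2)] \<omega>(1) by simp
    moreover have "upper_level_sets \<omega> \<noteq> {}" using bounds by blast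
    moreover have "\<forall>U\<in>upper_level_sets \<omega>. flat M U" using flat_upper_level_set[OF \<omega>(2)] by blast
    ultimately show ?thesis using chain_upper_level_sets unfolding D by blast
  qed
  moreover have "order_emb F D ?\<psi>"
    unfolding order_emb_def
  proof (intro conjI ballI)
    show "weak_partial_order F" "weak_partial_order D"
      unfolding F_def D_def by (rule weak_partial_order_bergman weak_partial_order_complex)+
    fix N N' assume "N \<in> carrier F" "N' \<in> carrier F"
    from F_cases[OF this(1)] F_cases[OF this(2)]
    obtain \<omega> \<omega>' where N: "N = matroid_type M \<omega>" "loopfree (matroid_type M \<omega>)"
      and N': "N' = matroid_type M \<omega>'" "loopfree (matroid_type M \<omega>')"
      by (elim exE conjE)
    have "?\<psi> N \<subseteq> ?\<psi> N' \<longleftrightarrow> bases N' \<subseteq> bases N"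
    proof
      assume sub: "?\<psi> N \<subseteq> ?\<psi> N'"
      \<comment> \<open>The upper level sets of \<open>\<omega>\<close> are tight for \<open>N\<close>, and bases for which they are tight are bases of \<open>N\<close>.\<close>
      have "upper_level_sets \<omega> \<subseteq> ?\<psi> N"
        unfolding N(1) closure[OF N(2)] by (rule decomp_closure_superset)
      from subset_trans[OF this sub] have "upper_level_sets \<omega> \<subseteq> tight_sets (bases N')"
        unfolding N'(1) bergman_to_decomp_eq_tight[OF N'(2)] .
      then have "bases N' \<subseteq> adapted_bases (upper_level_sets \<omega>)"
        using bases_matroid_type_subset[of \<omega>'] unfolding N'(1) adapted_bases_def tight_sets_def by auto
      then show "bases N' \<subseteq> bases N" using bases_matroid_type_eq_adapted N(1) by simp
    next
      assume "bases N' \<subseteq> bases N"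
      then show "?\<psi> N \<subseteq> ?\<psi> N'" unfolding bergman_to_decomp_def by blast
    qed
    then show "?\<psi> N \<sqsubseteq>\<^bsub>D\<^esub> ?\<psi> N' \<longleftrightarrow> N \<sqsubseteq>\<^bsub>F\<^esub> N'"
      by (simp add: D_def F_def decomposition_complex_def bergman_face_poset_def)
  qed
  moreover have "A \<in> ?\<psi> ` carrier F \<longleftrightarrow> {} \<in> A \<and> ground M \<in> A" if A: "A \<in> carrier D" for A
  proof
    assume "A \<in> ?\<psi> ` carrier F"
    then obtain N where "A = ?\<psi> N" "N \<in> carrier F" by (rule imageE)
    with F_cases obtain \<omega> where "A = ?\<psi> (matroid_type M \<omega>)" "loopfree (matroid_type M \<omega>)" by metis
    then show "{} \<in> A \<and> ground M \<in> A"
      using closure bounds[of \<omega>] decomp_closure_superset[of "upper_level_sets \<omega>" L] by auto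
  next
    assume bds: "{} \<in> A \<and> ground M \<in> A"
    obtain C0 where C0: "A = ?cl C0" "\<forall>c\<in>C0. flat M c" "chain\<^sub>\<subseteq> C0" using A unfolding D by blast
    \<comment> \<open>Adjoining two members of the closure does not change it.\<close>
    define C where "C = insert {} (insert (ground M) C0)"
    have flats: "\<forall>c\<in>C. flat M c" using C0(2) flat_empty[OF assms(2)] flat_ground unfolding C_def by blast
    then have sub: "\<forall>c\<in>C. c \<subseteq> ground M" unfolding flat_def by blast
    then have chain: "chain\<^sub>\<subseteq> C" using C0(3) unfolding C_def chain_subset_def by blast
    have "A = ?cl C"
    proof
      show "A \<subseteq> ?cl C" unfolding C0(1) decomp_closure_def C_def by (rule Inter_anti_mono) auto
      show "?cl C \<subseteq> A"
      proof (rule decomp_closure_least)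
        show "C \<subseteq> A" using bds decomp_closure_superset[of C0 L] C0(1) unfolding C_def by blast
        have "A \<subseteq> carrier L" unfolding C0(1)
          by (rule decomp_closure_least)
            (use C0(2) in \<open>auto simp: L_def carrier_flats decompositions_def\<close>)
        then show "A \<subseteq> carrier L" .
        show "z \<in> A" if "(x, z, y) \<in> decompositions L" "x \<in> A" "y \<in> A" for x z y
          using that unfolding C0(1) by (rule decomp_closure_closed)
      qed
    qed
    let ?w = "\<lambda>i. real (card {c \<in> C. i \<in> c})"
    have bases: "bases (matroid_type M ?w) = adapted_bases C"
      using bases_matroid_type_of_chain[OF chain sub] .
    have "{} \<in> C" "ground M \<in> C" unfolding C_def by auto
    then have "loopfree (matroid_type M ?w)"
      and "tight_sets (adapted_bases C) = A"
      using loopfree_matroid_type[of ?w] adapted_bases_cover[OF chain flats] bases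
        tight_adapted_eq_closure[OF chain flats] \<open>A = ?cl C\<close> unfolding L_def by auto
    then have "A = ?\<psi> (matroid_type M ?w)" "matroid_type M ?w \<in> carrier F"
      using bergman_to_decomp_eq_tight[of ?w] bases unfolding F by auto
    then show "A \<in> ?\<psi> ` carrier F" by blast
  qed
  moreover have "\<bottom>\<^bsub>L\<^esub> = {}" "\<top>\<^bsub>L\<^esub> = ground M"
    unfolding L_def using bottom_flats[OF assms(2)] top_flats by auto
  ultimately show ?thesis by simp
qed

end
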